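(* For every integer $m>1$ and every (arbitrarily small) $\varepsilon>0$, as $n\to\infty$, $$\mathbb P(G_m^n\text{ is connected})=1-O\left(\left(\frac{(\log\log n)^{1+\varepsilon}}{\log n}\right)^{\frac{m-1}{3}}\right).$$
   Context: The Bollobás–Riordan preferential attachment multigraph $G_m^n$: $G_1^1$ is a single vertex $1$ with a loop (a loop contributes $2$ to the degree); given $G_1^{t-1}$ on $[t-1]$, vertex $t$ is added together with one edge, which joins $t$ to $s\in[t-1]$ with probability $\deg_{G_1^{t-1}}(s)/(2t-1)$ and is a loop at $t$ with probability $1/(2t-1)$. $G_m^n$ is obtained from $G_1^{mn}$ by merging vertices $m(j-1)+1,\dots,mj$ into a single vertex $j$, $j=1,\dots,n$ (keeping multiple edges and loops). Equivalently (in distribution): let $w_1,\dots,w_{mn+1}$ be independent mean-$1$ exponentials, $W_k=\sum_{i\le k}w_i$, $R_k=W_k/W_{mn+1}$, $R_0=0$; conditionally on $\{W_k\}$ let $\ell_1,\dots,\ell_{mn}$ be independent, $\ell_k$ with density $\frac1{2\sqrt{R_kx}}$ on $(0,R_k]$; vertex $j$ is the interval $(R_{m(j-1)},R_{mj}]$ and for each $k\in[mn]$ there is one edge joining the vertices containing $R_k$ and $\ell_k$. The constant in $O(\cdot)$ may depend on $m$ and $\varepsilon$. *)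

theory Defs
  imports "HOL-Probability.Probability" "HOL-Library.Uprod" "HOL-Library.Landau_Symbols"
begin

text \<open>A multigraph is a vertex set together with a multiset of unordered pairs of vertices;
  \<open>Upair v v\<close> is a loop.\<close>

type_synonym 'a multigraph = "'a set \<times> 'a uprod multiset"

abbreviation mverts :: "'a multigraph \<Rightarrow> 'a set" where
  "mverts G \<equiv> fst G"

abbreviation medges :: "'a multigraph \<Rightarrow> 'a uprod multiset" where
  "medges G \<equiv> snd G"

definition mdegree :: "'a multigraph \<Rightarrow> 'a \<Rightarrow> nat" where
  "mdegree G v =
     (\<Sum>e\<in>#medges G. if e = Upair v v then 2 else if v \<in> set_uprod e then 1 else 0)"

definition mconnected :: "'a multigraph \<Rightarrow> bool" where
  "mconnected G \<longleftrightarrow>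
     (\<forall>u\<in>mverts G. \<forall>v\<in>mverts G. (\<lambda>x y. Upair x y \<in># medges G)\<^sup>*\<^sup>* u v)"

definition merge_vertices :: "('a \<Rightarrow> 'b) \<Rightarrow> 'a multigraph \<Rightarrow> 'b multigraph" where
  "merge_vertices f G = (f ` mverts G, image_mset (map_uprod f) (medges G))"

text \<open>The other end of the edge added with the new vertex \<open>t\<close>. The weights sum to 1 only if
  \<open>G\<close> is a multigraph on \<open>{1..<t}\<close> with \<open>t - 1\<close> edges, which is always so below: see the lemmas
  \<open>set_pmf_PA1\<close> and \<open>pmf_attach\<close>.\<close>

definition attach_pmf :: "nat multigraph \<Rightarrow> nat \<Rightarrow> nat pmf" where
  "attach_pmf G t = embed_pmf (\<lambda>s.
     if s \<in> {1..<t} then real (mdegree G s) / (2 * real t - 1)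
     else if s = t then 1 / (2 * real t - 1)
     else 0)"

fun PA1 :: "nat \<Rightarrow> nat multigraph pmf" where
  "PA1 0 = return_pmf ({}, {#})"
| "PA1 (Suc 0) = return_pmf ({1}, {#Upair 1 1#})"
| "PA1 (Suc (Suc k)) =
     (let t = Suc (Suc k) in
      do {
        G \<leftarrow> PA1 (Suc k);
        s \<leftarrow> attach_pmf G t;
        return_pmf (insert t (mverts G), add_mset (Upair t s) (medges G))
      })"

text \<open>Vertex \<open>i \<ge> 1\<close> lies in block \<open>(i - 1) div m + 1\<close>, i.e.\ in the block \<open>j\<close> with
  \<open>m * (j - 1) + 1 \<le> i \<le> m * j\<close>.\<close>

definition PA :: "nat \<Rightarrow> nat \<Rightarrow> nat multigraph pmf" where
  "PA m n = map_pmf (merge_vertices (\<lambda>i. (i - 1) div m + 1)) (PA1 (m * n))"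

lemma mdegree_handshake:
  assumes "finite V" "\<forall>e\<in>#E. set_uprod e \<subseteq> V"
  shows "(\<Sum>v\<in>V. mdegree (W, E) v) = 2 * size E"
  using assms(2)
proof (induction E)
  case empty
  then show ?case by (simp add: mdegree_def)
next
  case (add e E)
  obtain a b where e: "e = Upair a b" by (cases e)
  have ab: "a \<in> V" "b \<in> V" using add.prems e by auto
  have *: "(if Upair a b = Upair v v then 2 else if v \<in> set_uprod (Upair a b) then 1 else 0)
           = (if v = a then 1 else 0) + (if v = b then 1 else (0::nat))" for v
    by auto
  have "(\<Sum>v\<in>V. mdegree (W, add_mset e E) v) =
        (\<Sum>v\<in>V. (if v = a then 1 else 0) + (if v = b then 1 else 0) + mdegree (W, E) v)"
    unfolding mdegree_def e by (simp only: * snd_conv image_mset_add_mset sum_mset.add_mset)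
  also have "\<dots> = 2 + 2 * size E"
    using add ab assms(1) by (simp add: sum.distrib sum.delta)
  finally show ?case by simp
qed

lemma pmf_attach:
  assumes "t \<ge> 1" "size (medges G) = t - 1" "\<forall>e\<in>#medges G. set_uprod e \<subseteq> {1..<t}"
  shows "pmf (attach_pmf G t) s =
     (if s \<in> {1..<t} then real (mdegree G s) / (2 * real t - 1)
      else if s = t then 1 / (2 * real t - 1)
      else 0)"
proof -
  define f where "f s =
     (if s \<in> {1..<t} then real (mdegree G s) / (2 * real t - 1)
      else if s = t then 1 / (2 * real t - 1)
      else 0)" for s
  have pos: "f s \<ge> 0" for s using assms(1) by (simp add: f_def)
  have "(\<Sum>s\<in>{1..<t}. mdegree G s) = 2 * (t - 1)"
    using mdegree_handshake[of "{1..<t}" "medges G" "mverts G"] assms by simp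
  then have hs: "(\<Sum>s\<in>{1..<t}. real (mdegree G s)) = 2 * (real t - 1)"
    using assms(1) by (metis of_nat_1 of_nat_diff of_nat_mult of_nat_numeral of_nat_sum)
  have "{1..t} = insert t {1..<t}" using assms(1) by auto
  then have "(\<Sum>s\<in>{1..t}. f s) = f t + (\<Sum>s\<in>{1..<t}. f s)" by simp
  also have "(\<Sum>s\<in>{1..<t}. f s) = (\<Sum>s\<in>{1..<t}. real (mdegree G s)) / (2 * real t - 1)"
    unfolding sum_divide_distrib by (intro sum.cong) (auto simp: f_def)
  also have "f t + \<dots> = 1"
    unfolding hs using assms(1) by (simp add: f_def field_simps)
  finally have sum1: "(\<Sum>s\<in>{1..t}. f s) = 1" .
  have "(\<integral>\<^sup>+ s. ennreal (f s) \<partial>count_space UNIV) = (\<Sum>s\<in>{1..t}. ennreal (f s))"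
    by (rule nn_integral_count_space') (use assms(1) in \<open>auto simp: f_def\<close>)
  also have "\<dots> = 1" using sum1 pos by (simp add: sum_ennreal)
  finally have "pmf (embed_pmf f) s = f s" using pos by (intro pmf_embed_pmf) auto
  moreover have "attach_pmf G t = embed_pmf f" unfolding attach_pmf_def f_def ..
  ultimately show ?thesis by (simp add: f_def)
qed

lemma set_pmf_PA1:
  assumes "G \<in> set_pmf (PA1 t)"
  shows "mverts G = {1..t} \<and> size (medges G) = t \<and> (\<forall>e\<in>#medges G. set_uprod e \<subseteq> {1..t})"
  using assms
proof (induction t arbitrary: G rule: PA1.induct)
  case (3 k)
  then obtain H s where H: "H \<in> set_pmf (PA1 (Suc k))"
    and s: "s \<in> set_pmf (attach_pmf H (Suc (Suc k)))"
    and G: "G = (insert (Suc (Suc k)) (mverts H), add_mset (Upair (Suc (Suc k)) s) (medges H))"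
    by (auto simp: Let_def)
  have IH: "mverts H = {1..Suc k}" "size (medges H) = Suc k"
      "\<forall>e\<in>#medges H. set_uprod e \<subseteq> {1..Suc k}"
    using "3.IH"[OF refl H] by auto
  have "{1..<Suc (Suc k)} = {1..Suc k}" by auto
  then have "pmf (attach_pmf H (Suc (Suc k))) s = 0" if "s \<notin> {1..Suc (Suc k)}"
    using IH that by (subst pmf_attach) auto
  then have "s \<in> {1..Suc (Suc k)}" using s by (auto simp: set_pmf_iff)
  moreover have "{1..Suc (Suc k)} = insert (Suc (Suc k)) {1..Suc k}" by auto
  ultimately show ?case using IH unfolding G by auto
qed auto

end

theory Submission
  imports Defs "HOL-Real_Asymp.Real_Asymp"
begin

text \<open>If no edge of \<open>G_1^N\<close> leaves a vertex set \<open>T\<close> with \<open>a\<close> elements, then \<open>T\<close> has total degree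
  \<open>2a\<close>, since every vertex brings exactly one edge. Hence the probability of this event is a product
  of deterministic factors, \<open>(2a-1)!! (2b-1)!! / (2N-1)!!\<close> with \<open>b = N - a\<close>, which is at most
  \<open>1 / (N choose a)\<close>. For a union of \<open>s\<close> blocks out of \<open>n\<close> this is
  \<open>1 / (mn choose ms) \<le> (n choose s)^(-m)\<close>, and a union bound over all sets of blocks shows that
  \<open>G_m^n\<close> is disconnected with probability at most \<open>\<Sum>0<s<n. 1 / (n choose s) \<le> 4 / n\<close> as soon as
  \<open>m \<ge> 2\<close>. This is far stronger than the claimed bound.\<close>

section \<open>Uncrossed vertex sets and double factorials\<close>

definition uncrossed :: "'a set \<Rightarrow> 'a multigraph \<Rightarrow> bool" where
  "uncrossed T G \<longleftrightarrow> (\<forall>e\<in>#medges G. set_uprod e \<subseteq> T \<or> set_uprod e \<inter> T = {})"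

text \<open>The double factorial \<open>(2k-1)!!\<close>, that is, the product of the attachment
  denominators \<open>2t - 1\<close> over \<open>t = 1, ..., k\<close>.\<close>

definition odd_fact :: "nat \<Rightarrow> nat" where
  "odd_fact k = (\<Prod>i<k. 2 * i + 1)"

lemma odd_fact_0 [simp]: "odd_fact 0 = 1"
  by (simp add: odd_fact_def)

lemma odd_fact_Suc [simp]: "odd_fact (Suc k) = (2 * k + 1) * odd_fact k"
  by (simp add: odd_fact_def)

lemma odd_fact_pos [simp]: "odd_fact k > 0"
  by (simp add: odd_fact_def prod_pos)

lemma uncrossed_Compl: "uncrossed (- T) G \<longleftrightarrow> uncrossed T G"
  unfolding uncrossed_def by blast

lemma uncrossed_add_edge:
  "uncrossed T (V, add_mset (Upair t s) (medges G)) \<longleftrightarrow> (s \<in> T \<longleftrightarrow> t \<in> T) \<and> uncrossed T G"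
  unfolding uncrossed_def by auto

text \<open>For a new loop, \<open>s = t\<close>, both indicators fire and give the contribution
  2.\<close>

lemma mdegree_add_edge:
  "mdegree (V, add_mset (Upair t s) (medges G)) v =
     (if v = t then 1 else 0) + (if v = s then 1 else 0) + mdegree G v"
  by (auto simp: mdegree_def)

lemma mdegree_not_incident:
  assumes "\<forall>e\<in>#medges G. set_uprod e \<subseteq> V" "v \<notin> V"
  shows "mdegree G v = 0"
  unfolding mdegree_def using assms by (subst sum_mset.neutral) auto

section \<open>Probability that a vertex set is uncrossed\<close>

lemma set_pmf_PA1_SucE:
  assumes "G \<in> set_pmf (PA1 (Suc (Suc k)))"
  obtains H s where "H \<in> set_pmf (PA1 (Suc k))" "s \<in> {1..Suc (Suc k)}"
    "G = (insert (Suc (Suc k)) (mverts H), add_mset (Upair (Suc (Suc k)) s) (medges H))"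
proof -
  from assms obtain H s where "H \<in> set_pmf (PA1 (Suc k))"
    and G: "G = (insert (Suc (Suc k)) (mverts H), add_mset (Upair (Suc (Suc k)) s) (medges H))"
    by (auto simp: Let_def)
  moreover have "s \<in> {1..Suc (Suc k)}"
    using set_pmf_PA1[OF assms] unfolding G by auto
  ultimately show thesis using that by blast
qed

text \<open>The edge born with a vertex ends on the side of that vertex, so it adds 2 to the degree
  of that side and nothing to the other.\<close>

lemma sum_mdegree_uncrossed:
  assumes "G \<in> set_pmf (PA1 t)" "uncrossed T G"
  shows "(\<Sum>v\<in>T \<inter> {1..t}. mdegree G v) = 2 * card (T \<inter> {1..t})"
  using assms
proof (induction t arbitrary: G rule: PA1.induct)
  case 1
  then show ?case by simp
next
  case 2
  then show ?case by (cases "Suc 0 \<in> T") (auto simp: mdegree_def)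
next
  case (3 k)
  let ?t = "Suc (Suc k)"
  obtain H s where H: "H \<in> set_pmf (PA1 (Suc k))" and s: "s \<in> {1..?t}"
    and G: "G = (insert ?t (mverts H), add_mset (Upair ?t s) (medges H))"
    using set_pmf_PA1_SucE[OF "3.prems"(1)] by blast
  from "3.prems"(2) have same: "s \<in> T \<longleftrightarrow> ?t \<in> T" and "uncrossed T H"
    unfolding G uncrossed_add_edge by auto
  then have IH: "(\<Sum>v\<in>T \<inter> {1..Suc k}. mdegree H v) = 2 * card (T \<inter> {1..Suc k})"
    using "3.IH"[OF refl H] by blast
  \<comment> \<open>The new vertex meets no edge of \<open>H\<close>, so the old degree sum may be
    taken over the enlarged range.\<close>
  have new: "mdegree H ?t = 0"
    using set_pmf_PA1[OF H] by (intro mdegree_not_incident[of _ "{1..Suc k}"]) auto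
  have *: "(\<Sum>v\<in>T \<inter> {1..?t}. mdegree G v) =
      (\<Sum>v\<in>T \<inter> {1..?t}. if v = ?t then 1 else 0) + (\<Sum>v\<in>T \<inter> {1..?t}. if v = s then 1 else 0)
      + (\<Sum>v\<in>T \<inter> {1..?t}. mdegree H v)"
    unfolding G mdegree_add_edge by (simp add: sum.distrib)
  show ?case
  proof (cases "?t \<in> T")
    case True
    then have "T \<inter> {1..?t} = insert ?t (T \<inter> {1..Suc k})" by auto
    then have "(\<Sum>v\<in>T \<inter> {1..?t}. mdegree H v) = 2 * card (T \<inter> {1..Suc k})"
      "card (T \<inter> {1..?t}) = Suc (card (T \<inter> {1..Suc k}))"
      using IH new by auto
    then show ?thesis unfolding * using True same s by (simp add: sum.delta')
  next
    case False
    then have "T \<inter> {1..?t} = T \<inter> {1..Suc k}" using le_Suc_eq by auto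
    then show ?thesis unfolding * using False same IH by (auto simp: sum.delta')
  qed
qed

text \<open>The old vertices of \<open>T\<close> carry weight
  \<open>2 * card (T \<inter> {1..t})\<close> whatever \<open>G\<close> looks like, and the loop at
  \<open>Suc t\<close> adds 1. The denominator is \<open>2 * Suc t - 1\<close>.\<close>

lemma prob_attach_same_side:
  assumes G: "G \<in> set_pmf (PA1 t)" "uncrossed T G" and "Suc t \<in> T"
  shows "measure_pmf.prob (attach_pmf G (Suc t)) {s. s \<in> T} =
    real (2 * card (T \<inter> {1..t}) + 1) / real (2 * t + 1)"
proof -
  note inv = set_pmf_PA1[OF G(1)]
  have eq: "{1..<Suc t} = {1..t}" by auto
  have p: "pmf (attach_pmf G (Suc t)) s =
     (if s \<in> {1..t} then real (mdegree G s) / real (2 * t + 1)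
      else if s = Suc t then 1 / real (2 * t + 1) else 0)" for s
    using inv by (subst pmf_attach) (auto simp only: eq diff_Suc_1 atLeastAtMost_iff, auto)
  \<comment> \<open>\<open>T\<close> may be infinite; cutting it down to the support turns the
    probability into a finite sum.\<close>
  have supp: "set_pmf (attach_pmf G (Suc t)) \<subseteq> {1..Suc t}"
    by (auto simp: set_pmf_iff p split: if_splits)
  have "measure_pmf.prob (attach_pmf G (Suc t)) {s. s \<in> T} =
      measure_pmf.prob (attach_pmf G (Suc t)) (T \<inter> {1..Suc t})"
    using supp by (intro measure_pmf.finite_measure_eq_AE) (auto simp: AE_measure_pmf_iff)
  also have "\<dots> = (\<Sum>s\<in>T \<inter> {1..Suc t}. pmf (attach_pmf G (Suc t)) s)"
    by (simp add: measure_measure_pmf_finite)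
  also have "T \<inter> {1..Suc t} = insert (Suc t) (T \<inter> {1..t})" using assms(3) by auto
  also have "(\<Sum>s\<in>\<dots>. pmf (attach_pmf G (Suc t)) s) =
      1 / real (2 * t + 1) + (\<Sum>s\<in>T \<inter> {1..t}. real (mdegree G s) / real (2 * t + 1))"
    by (subst sum.insert) (auto simp: p)
  also have "(\<Sum>s\<in>T \<inter> {1..t}. real (mdegree G s) / real (2 * t + 1)) =
      real (2 * card (T \<inter> {1..t})) / real (2 * t + 1)"
    unfolding sum_divide_distrib[symmetric] sum_mdegree_uncrossed[OF G, symmetric] by simp
  finally show ?thesis by (simp add: add_divide_distrib)
qed

lemma prob_bind_pmf:
  "measure_pmf.prob (bind_pmf M f) A = (\<integral>x. measure_pmf.prob (f x) A \<partial>measure_pmf M)"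
  unfolding measure_pmf_bind
  by (rule measure_pmf.measure_bind[where N = "count_space UNIV"])
    (simp_all add: space_subprob_algebra measure_pmf.subprob_space_axioms)

text \<open>The conditional probability is the same for all uncrossed graphs, so it leaves the
  expectation as a constant. Crossed graphs contribute 0 because a crossing edge is never
  removed.\<close>

lemma prob_PA1_uncrossed_Suc:
  assumes "Suc (Suc k) \<in> T"
  shows "measure_pmf.prob (PA1 (Suc (Suc k))) {G. uncrossed T G} =
    real (2 * card (T \<inter> {1..Suc k}) + 1) / real (2 * Suc k + 1) *
      measure_pmf.prob (PA1 (Suc k)) {G. uncrossed T G}"
proof -
  let ?t = "Suc (Suc k)"
  let ?c = "real (2 * card (T \<inter> {1..Suc k}) + 1) / real (2 * Suc k + 1)"
  have step: "measure_pmf.prob (map_pmf (\<lambda>s. (insert ?t (mverts H),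
        add_mset (Upair ?t s) (medges H))) (attach_pmf H ?t)) {G. uncrossed T G} =
      ?c * indicator {G. uncrossed T G} H" if "H \<in> set_pmf (PA1 (Suc k))" for H
  proof (cases "uncrossed T H")
    case True
    then show ?thesis
      using prob_attach_same_side[OF that True assms] assms
      by (simp add: vimage_def uncrossed_add_edge)
  next
    case False
    then show ?thesis by (simp add: vimage_def uncrossed_add_edge)
  qed
  have "PA1 ?t = bind_pmf (PA1 (Suc k)) (\<lambda>H. map_pmf (\<lambda>s. (insert ?t (mverts H),
        add_mset (Upair ?t s) (medges H))) (attach_pmf H ?t))"
    by (simp add: Let_def map_pmf_def)
  then have "measure_pmf.prob (PA1 ?t) {G. uncrossed T G} =
      (\<integral>H. measure_pmf.prob (map_pmf (\<lambda>s. (insert ?t (mverts H),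
        add_mset (Upair ?t s) (medges H))) (attach_pmf H ?t)) {G. uncrossed T G} \<partial>PA1 (Suc k))"
    by (simp only: prob_bind_pmf)
  \<comment> \<open>\<open>step\<close> holds only on the support of \<open>PA1 (Suc k)\<close>,
    hence the almost-everywhere congruence.\<close>
  also have "\<dots> = (\<integral>H. ?c * indicator {G. uncrossed T G} H \<partial>PA1 (Suc k))"
    by (rule integral_cong_AE, simp, simp, rule AE_pmfI, rule step)
  finally show ?thesis by simp
qed

text \<open>A new vertex contributes the next odd factor of its own side over the next odd factor of
  the total, so the order of arrival of the two sides is irrelevant.\<close>

lemma prob_PA1_uncrossed:
  "measure_pmf.prob (PA1 t) {G. uncrossed T G} =
     real (odd_fact (card (T \<inter> {1..t}))) * real (odd_fact (card (- T \<inter> {1..t}))) /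
       real (odd_fact t)"
proof (induction t arbitrary: T rule: PA1.induct)
  case 1
  then show ?case by (simp add: uncrossed_def)
next
  case 2
  then show ?case by (cases "Suc 0 \<in> T") (auto simp: uncrossed_def)
next
  case (3 k)
  let ?t = "Suc (Suc k)"
  \<comment> \<open>Only the side that contains the newest vertex needs a computation; the other
    case follows by passing to the complement.\<close>
  have *: "measure_pmf.prob (PA1 ?t) {G. uncrossed U G} =
     real (odd_fact (card (U \<inter> {1..?t}))) * real (odd_fact (card (- U \<inter> {1..?t}))) /
       real (odd_fact ?t)" if "?t \<in> U" for U
  proof -
    have "U \<inter> {1..?t} = insert ?t (U \<inter> {1..Suc k})" using that by auto
    then have 1: "card (U \<inter> {1..?t}) = Suc (card (U \<inter> {1..Suc k}))" by simp
    have 2: "- U \<inter> {1..?t} = - U \<inter> {1..Suc k}" using that le_Suc_eq by auto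
    show ?thesis
      unfolding prob_PA1_uncrossed_Suc[OF that] "3.IH"[OF refl] 1 2 odd_fact_Suc[of "Suc k"]
        odd_fact_Suc[of "card (U \<inter> {1..Suc k})"] of_nat_mult
      by simp
  qed
  show ?case
  proof (cases "?t \<in> T")
    case False
    then show ?thesis using *[of "- T"] by (simp add: uncrossed_Compl mult.commute)
  qed (use * in blast)
qed

section \<open>Binomial estimates\<close>

lemma odd_fact_choose_le:
  "odd_fact a * odd_fact b * ((a + b) choose a) \<le> odd_fact (a + b)"
proof (induction a)
  case (Suc a)
  have c: "Suc a * ((Suc a + b) choose Suc a) = (a + b + 1) * ((a + b) choose a)"
    using Suc_times_binomial_eq[of "a + b" a] by (simp add: mult.commute)
  \<comment> \<open>Without denominators, this says that \<open>(2x+1)/(x+1) = 2 - 1/(x+1)\<close>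
    is no larger at \<open>x = a\<close> than at \<open>x = a + b\<close>.\<close>
  have le: "(2 * a + 1) * (a + b + 1) \<le> Suc a * (2 * (a + b) + 1)"
    by (simp add: algebra_simps)
  \<comment> \<open>The factor \<open>Suc a\<close> lets the recursion \<open>c\<close> apply
    without division; it is cancelled at the end.\<close>
  have "Suc a * (odd_fact (Suc a) * odd_fact b * ((Suc a + b) choose Suc a)) =
      (2 * a + 1) * odd_fact a * odd_fact b * (Suc a * ((Suc a + b) choose Suc a))"
    by (simp only: odd_fact_Suc ac_simps)
  also have "\<dots> = ((2 * a + 1) * (a + b + 1)) * (odd_fact a * odd_fact b * ((a + b) choose a))"
    unfolding c by (simp only: ac_simps)
  also have "\<dots> \<le> (Suc a * (2 * (a + b) + 1)) * odd_fact (a + b)"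
    by (rule mult_le_mono[OF le Suc.IH])
  also have "\<dots> = Suc a * odd_fact (Suc a + b)"
    by (simp only: odd_fact_Suc add_Suc mult.assoc)
  finally show ?case by (simp only: Suc_mult_le_cancel1)
qed simp

text \<open>The left side is a single term of Vandermonde's convolution.\<close>

lemma choose_mult_le_choose_add:
  "(a choose c) * (b choose d) \<le> ((a + b) choose (c + d))"
proof -
  have "(a choose c) * (b choose d) = (\<Sum>k\<in>{c}. (a choose k) * (b choose (c + d - k)))" by simp
  also have "\<dots> \<le> (\<Sum>k\<le>c + d. (a choose k) * (b choose (c + d - k)))"
    by (intro sum_mono2) auto
  finally show ?thesis by (simp add: vandermonde)
qed

text \<open>Choosing \<open>s\<close> elements in each of \<open>m\<close> disjoint copies of an
  \<open>n\<close>-set is one way to choose \<open>m * s\<close> elements of their union.\<close>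

lemma choose_power_le: "(n choose s) ^ m \<le> ((m * n) choose (m * s))"
proof (induction m)
  case (Suc m)
  have "(n choose s) ^ Suc m \<le> (n choose s) * ((m * n) choose (m * s))"
    using Suc.IH by simp
  also have "\<dots> \<le> ((n + m * n) choose (s + m * s))" by (rule choose_mult_le_choose_add)
  finally show ?case by simp
qed simp

text \<open>The terms \<open>s = 1\<close> and \<open>s = n - 1\<close> give \<open>1/n\<close>
  each. All others are at most \<open>1 / (n choose 2)\<close> and together give at most
  \<open>2/n\<close>.\<close>

lemma sum_inverse_choose_le:
  assumes "n \<ge> 4"
  shows "(\<Sum>s\<in>{0<..<n}. 1 / real (n choose s)) \<le> 4 / real n"
proof -
  have mid: "1 / real (n choose s) \<le> 2 / (real n * (real n - 1))" if s: "s \<in> {2..n - 2}" for s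
  proof -
    have "n choose 2 \<le> n choose s"
    proof (cases "2 * s \<le> n")
      case True
      then show ?thesis using s by (intro binomial_mono) auto
    next
      case False
      \<comment> \<open>Monotonicity holds up to the middle, so a large \<open>s\<close> is
        reflected to \<open>n - s\<close>.\<close>
      have "n choose 2 \<le> n choose (n - s)" using s False assms by (intro binomial_mono) auto
      also have "\<dots> = n choose s" using s assms by (intro binomial_symmetric[symmetric]) auto
      finally show ?thesis .
    qed
    moreover have "real (n choose 2) = real n * (real n - 1) / 2"
      using assms by (simp add: choose_two real_of_nat_div of_nat_diff)
    ultimately have "real n * (real n - 1) / 2 \<le> real (n choose s)"
      by (metis of_nat_le_iff)
    moreover have "real n * (real n - 1) / 2 > 0" using assms by simp
    ultimately have "1 / real (n choose s) \<le> 1 / (real n * (real n - 1) / 2)"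
      by (intro divide_left_mono mult_pos_pos) linarith+
    then show ?thesis by simp
  qed
  have split: "{0<..<n} = insert 1 (insert (n - 1) {2..n - 2})" using assms by auto
  have "(\<Sum>s\<in>{0<..<n}. 1 / real (n choose s)) =
      1 / real (n choose 1) + 1 / real (n choose (n - 1)) + (\<Sum>s\<in>{2..n - 2}. 1 / real (n choose s))"
  proof -
    have "1 \<notin> insert (n - 1) {2..n - 2}" "n - 1 \<notin> {2..n - 2}" using assms by auto
    then show ?thesis unfolding split by simp
  qed
  also have "n choose (n - 1) = n" using assms binomial_symmetric[of 1 n] by simp
  also have "(\<Sum>s\<in>{2..n - 2}. 1 / real (n choose s)) \<le>
      real (card {2..n - 2}) * (2 / (real n * (real n - 1)))"
    using mid by (rule sum_bounded_above)
  \<comment> \<open>The \<open>n - 3\<close> middle terms are counted as \<open>n - 1\<close> to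
    cancel a factor of the denominator.\<close>
  also have "\<dots> \<le> (real n - 1) * (2 / (real n * (real n - 1)))"
    using assms by (intro mult_right_mono) (auto simp: of_nat_diff)
  also have "\<dots> = 2 / real n" using assms by (simp add: divide_simps)
  finally show ?thesis by (simp add: field_simps)
qed

lemma prob_PA1_uncrossed_le:
  "measure_pmf.prob (PA1 t) {G. uncrossed T G} \<le> 1 / real (t choose card (T \<inter> {1..t}))"
proof -
  define a b where "a = card (T \<inter> {1..t})" and "b = card (- T \<inter> {1..t})"
  have "a + b = card (T \<inter> {1..t} \<union> - T \<inter> {1..t})"
    unfolding a_def b_def by (subst card_Un_disjoint) auto
  also have "T \<inter> {1..t} \<union> - T \<inter> {1..t} = {1..t}" by auto
  finally have t: "t = a + b" by simp
  have "real (odd_fact a) * real (odd_fact b) * real (t choose a) \<le> real (odd_fact t)"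
    using odd_fact_choose_le[of a b] unfolding t of_nat_mult[symmetric] of_nat_le_iff .
  then have "real (odd_fact a) * real (odd_fact b) / real (odd_fact t) \<le> 1 / real (t choose a)"
    using t by (simp add: field_simps)
  then show ?thesis unfolding prob_PA1_uncrossed a_def b_def .
qed

section \<open>Blocks of vertices and connectivity after merging\<close>

lemma block_eq_iff:
  assumes "m > 0" "j \<ge> 1" "i \<ge> (1::nat)"
  shows "(i - 1) div m + 1 = j \<longleftrightarrow> i \<in> {m * (j - 1) + 1..m * (j - 1) + m}"
proof -
  have "(i - 1) div m = j - 1 \<longleftrightarrow> m * (j - 1) \<le> i - 1 \<and> i - 1 < m * Suc (j - 1)"
  proof
    assume "(i - 1) div m = j - 1"
    then show "m * (j - 1) \<le> i - 1 \<and> i - 1 < m * Suc (j - 1)"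
      using times_div_less_eq_dividend[of m "i - 1"] dividend_less_times_div[OF assms(1), of "i - 1"]
      by simp
  qed (intro div_nat_eqI; simp)
  moreover have "m * Suc (j - 1) = m * (j - 1) + m" by simp
  moreover have "(i - 1) div m + 1 = j \<longleftrightarrow> (i - 1) div m = j - 1" using assms(2) by linarith
  \<comment> \<open>\<open>i \<ge> 1\<close> excludes \<open>i = 0\<close>, which truncated
    subtraction would put into block 1.\<close>
  ultimately show ?thesis using assms(3) unfolding atLeastAtMost_iff by linarith
qed

text \<open>The preimage of \<open>S\<close> is a disjoint union of intervals of length
  \<open>m\<close>, each inside \<open>{1..m * n}\<close>.\<close>

lemma card_union_blocks:
  assumes m: "m > 0" and S: "S \<subseteq> {1..n}"
  shows "card ({i. (i - 1) div m + 1 \<in> S} \<inter> {1..m * n}) = m * card S"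
proof -
  have fin: "finite S" using S finite_subset by blast
  have sub: "m * (j - 1) + m \<le> m * n" if "j \<in> S" for j
  proof -
    have "1 \<le> j" "j \<le> n" using that S by auto
    then have "m * (j - 1) + m = m * j" by (cases j) auto
    then show ?thesis using \<open>j \<le> n\<close> by simp
  qed
  have "{i. (i - 1) div m + 1 \<in> S} \<inter> {1..m * n} =
      (\<Union>j\<in>S. {i\<in>{1..m * n}. (i - 1) div m + 1 = j})" by auto
  also have "\<dots> = (\<Union>j\<in>S. {m * (j - 1) + 1..m * (j - 1) + m})"
  proof (intro SUP_cong refl)
    fix j assume j: "j \<in> S"
    then have "j \<ge> 1" using S by auto
    have "{i\<in>{1..m * n}. (i - 1) div m + 1 = j} =
        {i\<in>{1..m * n}. i \<in> {m * (j - 1) + 1..m * (j - 1) + m}}"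
      using block_eq_iff[OF m \<open>j \<ge> 1\<close>] by (intro Collect_cong conj_cong refl) simp
    also have "\<dots> = {m * (j - 1) + 1..m * (j - 1) + m}" using sub[OF j] by auto
    finally show "{i\<in>{1..m * n}. (i - 1) div m + 1 = j} = {m * (j - 1) + 1..m * (j - 1) + m}" .
  qed
  also have "card \<dots> = (\<Sum>j\<in>S. card {m * (j - 1) + 1..m * (j - 1) + m})"
  proof (intro card_UN_disjoint fin ballI impI)
    fix j k assume jk: "j \<in> S" "k \<in> S" "j \<noteq> k"
    then have "j \<ge> 1" "k \<ge> 1" using S by auto
    have False if "i \<in> {m * (j - 1) + 1..m * (j - 1) + m}"
      "i \<in> {m * (k - 1) + 1..m * (k - 1) + m}" for i
    proof -
      have "i \<ge> 1" using that by simp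
      then have "(i - 1) div m + 1 = j" "(i - 1) div m + 1 = k"
        using that block_eq_iff[OF m \<open>j \<ge> 1\<close>] block_eq_iff[OF m \<open>k \<ge> 1\<close>] by blast+
      then show False using jk by simp
    qed
    then show "{m * (j - 1) + 1..m * (j - 1) + m} \<inter> {m * (k - 1) + 1..m * (k - 1) + m} = {}"
      by blast
  qed auto
  finally show ?thesis by simp
qed

text \<open>\<open>S\<close> is the component of a vertex \<open>u\<close> in the merged graph, and
  some \<open>v\<close> lies outside it. No merged edge leaves a component, so its preimage is
  uncrossed.\<close>

lemma not_mconnected_merge_uncrossed:
  assumes dis: "\<not> mconnected (merge_vertices f G)"
    and inc: "\<forall>e\<in>#medges G. set_uprod e \<subseteq> mverts G"
  obtains S where "S \<subseteq> f ` mverts G" "S \<noteq> {}" "S \<noteq> f ` mverts G" "uncrossed {i. f i \<in> S} G"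
proof -
  define R where "R = (\<lambda>x y. Upair x y \<in># medges (merge_vertices f G))"
  obtain u v where uv: "u \<in> f ` mverts G" "v \<in> f ` mverts G" "\<not> R\<^sup>*\<^sup>* u v"
    using dis unfolding mconnected_def R_def by (auto simp: merge_vertices_def)
  define S where "S = {w \<in> f ` mverts G. R\<^sup>*\<^sup>* u w}"
  have "uncrossed {i. f i \<in> S} G"
    unfolding uncrossed_def
  proof
    fix e assume e: "e \<in># medges G"
    obtain a b where ab: "e = Upair a b" by (cases e)
    have "map_uprod f e \<in># medges (merge_vertices f G)"
      using e by (simp add: merge_vertices_def)
    \<comment> \<open>Edges are unordered, so reachability passes along an edge in both
      directions.\<close>
    moreover have "Upair (f b) (f a) = Upair (f a) (f b)" by (simp add: Upair_inject)
    ultimately have "R (f a) (f b)" "R (f b) (f a)" unfolding R_def ab by (metis map_uprod_simps)+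
    moreover have "a \<in> mverts G" "b \<in> mverts G" using inc e ab by auto
    ultimately have "f a \<in> S \<longleftrightarrow> f b \<in> S"
      unfolding S_def by (auto intro: rtranclp.rtrancl_into_rtrancl)
    then show "set_uprod e \<subseteq> {i. f i \<in> S} \<or> set_uprod e \<inter> {i. f i \<in> S} = {}"
      unfolding ab by auto
  qed
  moreover have "u \<in> S" "v \<notin> S" "S \<subseteq> f ` mverts G" using uv by (auto simp: S_def)
  ultimately show thesis using uv(2) that[of S] by blast
qed

text \<open>Union bound over the \<open>n choose s\<close> sets of \<open>s\<close> blocks, each
  uncrossed with probability at most \<open>(n choose s)^(-m)\<close>. With \<open>m \<ge> 2\<close>
  the count cancels and at least one inverse factor is left.\<close>

lemma prob_PA_disconnected_le:
  assumes m: "m \<ge> 2"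
  shows "1 - measure_pmf.prob (PA m n) {G. mconnected G} \<le>
    (\<Sum>s\<in>{0<..<n}. 1 / real (n choose s))"
proof -
  define f where "f i = (i - 1) div m + 1" for i
  define A where "A s = {S. S \<subseteq> {1..n} \<and> card S = s}" for s
  let ?E = "\<lambda>S. {G. uncrossed {i. f i \<in> S} G}"
  have finA: "finite (A s)" for s
    unfolding A_def by (rule finite_subset[of _ "Pow {1..n}"]) auto
  have blocks: "f ` {1..m * n} \<subseteq> {1..n}"
  proof safe
    fix i assume "i \<in> {1..m * n}"
    then have "(i - 1) div m < n"
      using m by (subst div_less_iff_less_mult) (auto simp: mult.commute)
    then show "f i \<in> {1..n}" by (auto simp: f_def)
  qed
  have cover: "G \<in> (\<Union>s\<in>{0<..<n}. \<Union>S\<in>A s. ?E S)"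
    if G: "G \<in> set_pmf (PA1 (m * n))" and dis: "\<not> mconnected (merge_vertices f G)" for G
  proof -
    note inv = set_pmf_PA1[OF G]
    obtain S where S: "S \<subseteq> f ` mverts G" "S \<noteq> {}" "S \<noteq> f ` mverts G" "uncrossed {i. f i \<in> S} G"
      using not_mconnected_merge_uncrossed[OF dis] inv by blast
    have sub: "S \<subset> {1..n}" using S(1,3) blocks inv by auto
    then have "card S < n" using psubset_card_mono[of "{1..n}" S] by simp
    moreover have "card S > 0"
      using S(2) sub finite_subset[of S "{1..n}"] by (auto simp: card_gt_0_iff)
    moreover have "S \<in> A (card S)" using sub by (auto simp: A_def)
    ultimately show ?thesis using S(4) by auto
  qed
  have one: "measure_pmf.prob (PA1 (m * n)) (?E S) \<le> 1 / real ((n choose s) ^ 2)"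
    if S: "S \<in> A s" and s: "s \<in> {0<..<n}" for s S
  proof -
    have "card ({i. f i \<in> S} \<inter> {1..m * n}) = m * s"
      using card_union_blocks[of m S n] S m unfolding A_def f_def by auto
    then have "measure_pmf.prob (PA1 (m * n)) (?E S) \<le> 1 / real ((m * n) choose (m * s))"
      using prob_PA1_uncrossed_le[of "m * n" "{i. f i \<in> S}"] by simp
    also have "\<dots> \<le> 1 / real ((n choose s) ^ 2)"
    proof -
      have pos: "n choose s > 0" using s by simp
      then have "(n choose s) ^ 2 \<le> (n choose s) ^ m" using m by (intro power_increasing) linarith+
      also have "\<dots> \<le> (m * n) choose (m * s)" by (rule choose_power_le)
      finally have "real ((n choose s) ^ 2) \<le> real ((m * n) choose (m * s))"
        by (simp only: of_nat_le_iff)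
      moreover have "real ((n choose s) ^ 2) > 0" using pos by simp
      ultimately show ?thesis by (intro divide_left_mono mult_pos_pos) linarith+
    qed
    finally show ?thesis .
  qed
  have "1 - measure_pmf.prob (PA m n) {G. mconnected G} =
      measure_pmf.prob (PA m n) {G. \<not> mconnected G}"
    using measure_pmf.prob_compl[of "{G. mconnected G}" "PA m n"] by (simp add: Compl_eq set_diff_eq)
  also have "\<dots> = measure_pmf.prob (PA1 (m * n)) {G. \<not> mconnected (merge_vertices f G)}"
    by (simp add: PA_def f_def[abs_def] vimage_def)
  \<comment> \<open>The inclusion \<open>cover\<close> is known only for graphs in the
    support.\<close>
  also have "\<dots> \<le> measure_pmf.prob (PA1 (m * n)) (\<Union>s\<in>{0<..<n}. \<Union>S\<in>A s. ?E S)"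
    using cover by (intro measure_pmf.finite_measure_mono_AE) (auto simp: AE_measure_pmf_iff)
  also have "\<dots> \<le> (\<Sum>s\<in>{0<..<n}. measure_pmf.prob (PA1 (m * n)) (\<Union>S\<in>A s. ?E S))"
    by (intro measure_UNION_le) auto
  also have "\<dots> \<le> (\<Sum>s\<in>{0<..<n}. 1 / real (n choose s))"
  proof (intro sum_mono)
    fix s assume s: "s \<in> {0<..<n}"
    have "measure_pmf.prob (PA1 (m * n)) (\<Union>S\<in>A s. ?E S) \<le>
        (\<Sum>S\<in>A s. measure_pmf.prob (PA1 (m * n)) (?E S))"
      using finA by (intro measure_UNION_le) auto
    also have "\<dots> \<le> real (card (A s)) * (1 / real ((n choose s) ^ 2))"
      using one s by (intro sum_bounded_above) auto
    also have "card (A s) = n choose s"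
      unfolding A_def using n_subsets[of "{1..n}" s] by simp
    finally show "measure_pmf.prob (PA1 (m * n)) (\<Union>S\<in>A s. ?E S) \<le> 1 / real (n choose s)"
      using s by (simp add: power2_eq_square)
  qed
  finally show ?thesis .
qed

section \<open>Comparison with the claimed rate\<close>

theorem theorem4p3:
  fixes m :: nat and \<epsilon> :: real
  assumes "m > 1" and "\<epsilon> > 0"
  shows "(\<lambda>n. 1 - measure_pmf.prob (PA m n) {G. mconnected G})
           \<in> O(\<lambda>n. (ln (ln (real n)) powr (1 + \<epsilon>) / ln (real n)) powr ((real m - 1) / 3))"
proof -
  define p where "p = (real m - 1) / 3"
  have p: "p > 0" using assms(1) by (simp add: p_def)
  have "(\<lambda>n. 1 - measure_pmf.prob (PA m n) {G. mconnected G}) \<in> O(\<lambda>n. 1 / real n)"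
  proof (rule bigoI[where c = 4], rule eventually_mono[OF eventually_ge_at_top[of 4]])
    fix n :: nat assume "n \<ge> 4"
    then have "1 - measure_pmf.prob (PA m n) {G. mconnected G} \<le> 4 / real n"
      using prob_PA_disconnected_le[of m n] sum_inverse_choose_le[of n] assms(1) by simp
    then show "norm (1 - measure_pmf.prob (PA m n) {G. mconnected G}) \<le> 4 * norm (1 / real n)"
      by simp
  qed
  \<comment> \<open>Every fixed power of \<open>ln n\<close> grows more slowly than
    \<open>n\<close>.\<close>
  also have "(\<lambda>n. 1 / real n) \<in> O(\<lambda>n. (1 / ln (real n)) powr p)"
    using p by real_asymp
  \<comment> \<open>The iterated logarithm in the numerator only enlarges the target: its power is
    at least 1 once \<open>ln (ln n) \<ge> 1\<close>.\<close>
  also have "(\<lambda>n. (1 / ln (real n)) powr p) \<in>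
      O(\<lambda>n. (ln (ln (real n)) powr (1 + \<epsilon>) / ln (real n)) powr p)"
  proof (rule bigoI[where c = 1])
    have "eventually (\<lambda>n. ln (real n) > 0) sequentially"
      "eventually (\<lambda>n. ln (ln (real n)) \<ge> 1) sequentially"
      by real_asymp+
    then show "eventually (\<lambda>n. norm ((1 / ln (real n)) powr p) \<le>
      1 * norm ((ln (ln (real n)) powr (1 + \<epsilon>) / ln (real n)) powr p)) sequentially"
    proof eventually_elim
      case (elim n)
      have "1 \<le> ln (ln (real n)) powr (1 + \<epsilon>)"
        using elim assms(2) by (intro ge_one_powr_ge_zero) auto
      then show ?case
        using elim p by (auto intro!: powr_mono2 divide_right_mono)
    qed
  qed
  finally show ?thesis unfolding p_def .
qed

end
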